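(* Let $\lambda$ be a nonzero real number. Then $$d_{n,\lambda}(x)=\sum_{l=0}^{n}\binom{n}{l}d_{l,\lambda}\,(x)_{n-l,\lambda}\quad (n\ge 0),$$ $$(x-1)_{n,\lambda}=d_{n,\lambda}(x)-n\,d_{n-1,\lambda}(x)\quad(n\ge1),$$ $$(-1)_{n,\lambda}=d_{n,\lambda}-n\,d_{n-1,\lambda}\quad(n\ge1).$$
   Context: For a nonzero real $\lambda$, the degenerate falling factorial is $(x)_{0,\lambda}=1$ and $(x)_{n,\lambda}=x(x-\lambda)\cdots(x-(n-1)\lambda)$ for $n\ge1$. The degenerate exponential function is $e_{\lambda}^{x}(t)=(1+\lambda t)^{x/\lambda}=\sum_{n\ge0}(x)_{n,\lambda}\frac{t^n}{n!}$ (as a formal power series in $t$). The degenerate derangement polynomials $d_{n,\lambda}(x)$ are defined by $$\frac{1}{1-t}e_{\lambda}^{x-1}(t)=\sum_{n=0}^{\infty}d_{n,\lambda}(x)\frac{t^n}{n!},$$ and the degenerate derangement numbers are $d_{n,\lambda}=d_{n,\lambda}(0)$. *)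

theory Defs
  imports Complex_Main "HOL-Computational_Algebra.Formal_Power_Series"
begin

definition degen_ffact :: "real \<Rightarrow> real \<Rightarrow> nat \<Rightarrow> real" where
  "degen_ffact l x n = (\<Prod>i<n. x - real i * l)"

definition degen_exp :: "real \<Rightarrow> real \<Rightarrow> real fps" where
  "degen_exp l x = Abs_fps (\<lambda>n. degen_ffact l x n / fact n)"

(* For nonzero l the series above is the formal binomial series (1 + l t)^(x/l). *)
lemma degen_exp_eq_binomial:
  assumes "l \<noteq> 0"
  shows "degen_exp l x = fps_compose (fps_binomial (x / l)) (fps_const l * fps_X)"
proof (rule fps_ext)
  fix n
  have "degen_ffact l x n = (\<Prod>i<n. l * (x / l - real i))"
    unfolding degen_ffact_def using assms by (intro prod.cong) (auto simp: field_simps)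
  also have "\<dots> = l ^ n * (\<Prod>i<n. x / l - real i)"
    by (simp add: prod.distrib)
  finally show "fps_nth (degen_exp l x) n =
      fps_nth (fps_compose (fps_binomial (x / l)) (fps_const l * fps_X)) n"
    by (simp add: degen_exp_def fps_compose_linear gbinomial_prod_rev atLeast0LessThan)
qed

(* The coefficient of t^n/n! in e_l^(x-1)(t) / (1 - t). *)
definition degen_derangement_poly :: "real \<Rightarrow> nat \<Rightarrow> real \<Rightarrow> real" where
  "degen_derangement_poly l n x =
     fact n * fps_nth (1 / (1 - fps_X) * degen_exp l (x - 1)) n"

lemma degen_derangement_poly_egf:
  "1 / (1 - fps_X) * degen_exp l (x - 1) =
     Abs_fps (\<lambda>n. degen_derangement_poly l n x / fact n)"
  by (rule fps_ext) (simp add: degen_derangement_poly_def)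

definition degen_derangement :: "real \<Rightarrow> nat \<Rightarrow> real" where
  "degen_derangement l n = degen_derangement_poly l n 0"

end

theory Submission
  imports Defs
begin

text \<open>Both recurrences say that multiplying the generating function by \<open>1 - t\<close> gives
  \<open>e\<^sub>\<lambda>\<^sup>x\<^sup>-\<^sup>1(t)\<close>; the convolution formula is the factorization
  \<open>e\<^sub>\<lambda>\<^sup>x\<^sup>-\<^sup>1(t) = e\<^sub>\<lambda>\<^sup>-\<^sup>1(t) e\<^sub>\<lambda>\<^sup>x(t)\<close>.\<close>

text \<open>Exponents add for the binomial series (Vandermonde), and substituting
  \<open>l * t\<close> respects products. Here \<open>l \<noteq> 0\<close> gives access to the
  binomial form.\<close>

lemma degen_exp_add:
  assumes "l \<noteq> 0"
  shows "degen_exp l (x + y) = degen_exp l x * degen_exp l y"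
  using assms
  by (simp add: degen_exp_eq_binomial add_divide_distrib fps_binomial_add_mult
      fps_compose_mult_distrib)

lemma degen_derangement_poly_convolution:
  assumes "l \<noteq> 0"
  shows "degen_derangement_poly l n x =
    (\<Sum>k=0..n. real (n choose k) * degen_derangement l k * degen_ffact l x (n - k))"
proof -
  \<comment> \<open>The exponent splits as \<open>-1 + x\<close>. Writing \<open>0 - 1\<close>
    exhibits the first factor as the generating function at \<open>x = 0\<close>, that of the
    derangement numbers.\<close>
  have "1 / (1 - fps_X) * degen_exp l (x - 1) =
      (1 / (1 - fps_X) * degen_exp l (0 - 1)) * degen_exp l x"
    using degen_exp_add[OF assms, of "-1" x] by (simp add: mult.assoc)
  also have "\<dots> = Abs_fps (\<lambda>n. degen_derangement l n / fact n) * degen_exp l x"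
    unfolding degen_derangement_poly_egf degen_derangement_def ..
  finally have "degen_derangement_poly l n x =
      fact n * (\<Sum>k=0..n. degen_derangement l k / fact k * (degen_ffact l x (n - k) / fact (n - k)))"
    by (simp add: degen_derangement_poly_def fps_mult_nth degen_exp_def)
  also have "\<dots> = (\<Sum>k=0..n. real (n choose k) * degen_derangement l k * degen_ffact l x (n - k))"
    unfolding sum_distrib_left by (intro sum.cong) (auto simp: binomial_fact)
  finally show ?thesis .
qed

lemma degen_derangement_poly_recurrence:
  assumes "n \<ge> 1"
  shows "degen_ffact l (x - 1) n =
    degen_derangement_poly l n x - real n * degen_derangement_poly l (n - 1) x"
proof -
  obtain m where n: "n = Suc m"
    using assms by (cases n) auto
  define D where "D = 1 / (1 - fps_X) * degen_exp l (x - 1)"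
  \<comment> \<open>The constant coefficient of \<open>1 - fps_X\<close> is 1, so it is a unit and
    the quotient is a true inverse.\<close>
  have "(1 - fps_X) * (1 / (1 - fps_X)) = (1 :: real fps)"
    using inverse_mult_eq_1'[of "1 - fps_X :: real fps"] fps_divide_unit[of "1 - fps_X :: real fps" 1] by simp
  then have "degen_exp l (x - 1) = (1 - fps_X) * D"
    by (simp add: D_def flip: mult.assoc)
  then have "fps_nth (degen_exp l (x - 1)) n = fps_nth D n - fps_nth D m"
    by (simp add: n left_diff_distrib)
  then have "degen_ffact l (x - 1) n = fact n * (fps_nth D n - fps_nth D m)"
    by (simp add: degen_exp_def field_simps)
  \<comment> \<open>Since \<open>fact n = n * fact m\<close>, the shifted coefficient of
    \<open>D\<close> contributes \<open>n\<close> times the polynomial of index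
    \<open>m = n - 1\<close>.\<close>
  then show ?thesis
    by (simp add: n degen_derangement_poly_def right_diff_distrib mult.assoc flip: D_def)
qed

theorem theorem2:
  fixes l :: real
  assumes "l \<noteq> 0"
  shows "(\<forall>(n::nat) (x::real). degen_derangement_poly l n x =
            (\<Sum>k=0..n. real (n choose k) * degen_derangement l k * degen_ffact l x (n - k))) \<and>
         (\<forall>(n::nat) (x::real). n \<ge> 1 \<longrightarrow>
            degen_ffact l (x - 1) n =
            degen_derangement_poly l n x - real n * degen_derangement_poly l (n - 1) x) \<and>
         (\<forall>n::nat. n \<ge> 1 \<longrightarrow>
            degen_ffact l (-1) n = degen_derangement l n - real n * degen_derangement l (n - 1))"
  \<comment> \<open>The third identity is the second at \<open>x = 0\<close>.\<close>
  using degen_derangement_poly_convolution[OF assms] degen_derangement_poly_recurrence[of _ l]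
    degen_derangement_poly_recurrence[of _ l 0, simplified, folded degen_derangement_def]
  by auto

end
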